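(* The LQ cost function $c=c^{0,T}$ is a homogeneous polynomial of degree $2$ of the form \begin{equation} c(x,y)=\frac{x^*R_3(T)^{-1}R_4(T)x}{2}-x^*R_3(T)^{-1}y-\frac{y^*R_3^{-1}(-T)R_4(-T)y}{2},\qquad x,y\in\mathbb{R}^n. \end{equation}
   Context: Let $n,m\in\mathbb{N}$, $m\leq n$, $A\in\mathbb{R}^{n\times n}$, $B\in\mathbb{R}^{n\times m}$ of rank $m$, $Q\in\mathbb{R}^{n\times n}$ symmetric, and let $(A,B,Q,T)$ be the LQ optimal control problem of minimizing $\mathcal{A}(\gamma)=\frac12\int_0^T(|u|^2-\gamma^*Q\gamma)\,d\tau$ over admissible trajectories $\dot\gamma=A\gamma+Bu$, $u\in L^2$, with fixed endpoints; the LQ cost $c(x,y)$ is the infimum of this action among trajectories joining $x$ to $y$. Assume the Kalman condition $\mathrm{span}\{A^jb_i\}=\mathbb{R}^n$ ($b_i$ the columns of $B$) and $T<t^*$, where $t^*\in(0,+\infty]$ is the first conjugate time of the Hamiltonian system. Let $\Omega=\begin{pmatrix}\mathbb{0}_n & \mathbb{1}_n\\ -\mathbb{1}_n & \mathbb{0}_n\end{pmatrix}$, $H=\begin{pmatrix}BB^* & A\\ A^* & Q\end{pmatrix}$, and \begin{equation} e^{-\tau\Omega H}=\begin{pmatrix}R_1(\tau) & R_2(\tau)\\ R_3(\tau) & R_4(\tau)\end{pmatrix},\qquad\tau\in\mathbb{R}, \end{equation} the associated Hamiltonian flow. *)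

theory Defs
  imports "HOL-Analysis.Analysis"
begin

primrec mpow :: "real^'k::finite^'k::finite \<Rightarrow> nat \<Rightarrow> real^'k::finite^'k::finite" where
  "mpow M 0 = mat 1"
| "mpow M (Suc j) = M ** mpow M j"

definition mexp :: "real^'k::finite^'k::finite \<Rightarrow> real^'k::finite^'k::finite" where
  "mexp M = (\<Sum>j. (1 / fact j) *\<^sub>R mpow M j)"

definition block :: "real^'n::finite^'n::finite \<Rightarrow> real^'n::finite^'n::finite \<Rightarrow> real^'n::finite^'n::finite \<Rightarrow> real^'n::finite^'n::finite
                      \<Rightarrow> real^('n::finite+'n)^('n::finite+'n)" where
  "block M1 M2 M3 M4 = (\<chi> i j. case i of
       Inl a \<Rightarrow> (case j of Inl b \<Rightarrow> M1 $ a $ b | Inr b \<Rightarrow> M2 $ a $ b)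
     | Inr a \<Rightarrow> (case j of Inl b \<Rightarrow> M3 $ a $ b | Inr b \<Rightarrow> M4 $ a $ b))"

definition blk1 :: "real^('n::finite+'n)^('n::finite+'n) \<Rightarrow> real^'n::finite^'n::finite" where
  "blk1 M = (\<chi> a b. M $ Inl a $ Inl b)"
definition blk2 :: "real^('n::finite+'n)^('n::finite+'n) \<Rightarrow> real^'n::finite^'n::finite" where
  "blk2 M = (\<chi> a b. M $ Inl a $ Inr b)"
definition blk3 :: "real^('n::finite+'n)^('n::finite+'n) \<Rightarrow> real^'n::finite^'n::finite" where
  "blk3 M = (\<chi> a b. M $ Inr a $ Inl b)"
definition blk4 :: "real^('n::finite+'n)^('n::finite+'n) \<Rightarrow> real^'n::finite^'n::finite" where
  "blk4 M = (\<chi> a b. M $ Inr a $ Inr b)"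

definition Omega :: "real^('n::finite+'n)^('n::finite+'n)" where
  "Omega = block 0 (mat 1) (- mat 1) 0"

definition Hmat :: "real^'n::finite^'n::finite \<Rightarrow> real^'m::finite^'n::finite \<Rightarrow> real^'n::finite^'n::finite \<Rightarrow> real^('n::finite+'n)^('n::finite+'n)" where
  "Hmat A B Q = block (B ** transpose B) A (transpose A) Q"

definition flow :: "real^'n::finite^'n::finite \<Rightarrow> real^'m::finite^'n::finite \<Rightarrow> real^'n::finite^'n::finite \<Rightarrow> real \<Rightarrow> real^('n::finite+'n)^('n::finite+'n)" where
  "flow A B Q \<tau> = mexp ((- \<tau>) *\<^sub>R (Omega ** Hmat A B Q))"

definition R1 where "R1 A B Q \<tau> = blk1 (flow A B Q \<tau>)"
definition R2 where "R2 A B Q \<tau> = blk2 (flow A B Q \<tau>)"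
definition R3 where "R3 A B Q \<tau> = blk3 (flow A B Q \<tau>)"
definition R4 where "R4 A B Q \<tau> = blk4 (flow A B Q \<tau>)"

definition pairvec :: "real^'n::finite \<Rightarrow> real^'n::finite \<Rightarrow> real^('n::finite+'n)" where
  "pairvec p x = (\<chi> i. case i of Inl a \<Rightarrow> p $ a | Inr a \<Rightarrow> x $ a)"
definition xpart :: "real^('n::finite+'n) \<Rightarrow> real^'n::finite" where
  "xpart z = (\<chi> a. z $ Inr a)"

(* t > 0 is a conjugate time: a nontrivial solution z(tau) = flow(tau) z0 of the Hamiltonian
   system with x(0) = 0 and x(t) = 0. *)
definition conjugate_time :: "real^'n::finite^'n::finite \<Rightarrow> real^'m::finite^'n::finite \<Rightarrow> real^'n::finite^'n::finite \<Rightarrow> real \<Rightarrow> bool" where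
  "conjugate_time A B Q t \<longleftrightarrow> 0 < t \<and>
     (\<exists>p0. p0 \<noteq> 0 \<and> xpart (flow A B Q t *v pairvec p0 0) = 0)"

definition first_conj_time :: "real^'n::finite^'n::finite \<Rightarrow> real^'m::finite^'n::finite \<Rightarrow> real^'n::finite^'n::finite \<Rightarrow> ereal" where
  "first_conj_time A B Q = Inf {ereal t | t. conjugate_time A B Q t}"

definition kalman :: "real^'n::finite^'n::finite \<Rightarrow> real^'m::finite^'n::finite \<Rightarrow> bool" where
  "kalman A B \<longleftrightarrow> span {mpow A j *v column i B | i j. True} = UNIV"

(* admissible pair on [0,T]: u in L^2(0,T), gamma continuous (absolutely continuous) solution of
   gamma' = A gamma + B u in integral form *)
definition admissible :: "real^'n::finite^'n::finite \<Rightarrow> real^'m::finite^'n::finite \<Rightarrow> real \<Rightarrow> (real \<Rightarrow> real^'n::finite) \<Rightarrow> (real \<Rightarrow> real^'m::finite) \<Rightarrow> bool" where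
  "admissible A B T \<gamma> u \<longleftrightarrow>
     set_borel_measurable lborel {0..T} u \<and>
     set_integrable lborel {0..T} (\<lambda>s. (norm (u s))\<^sup>2) \<and>
     continuous_on {0..T} \<gamma> \<and>
     (\<forall>t\<in>{0..T}. \<gamma> t = \<gamma> 0 + (LINT s:{0..t}|lborel. A *v \<gamma> s + B *v u s))"

definition action :: "real^'n::finite^'n::finite \<Rightarrow> real \<Rightarrow> (real \<Rightarrow> real^'n::finite) \<Rightarrow> (real \<Rightarrow> real^'m::finite) \<Rightarrow> real" where
  "action Q T \<gamma> u = (1/2) * (LINT s:{0..T}|lborel. (norm (u s))\<^sup>2 - \<gamma> s \<bullet> (Q *v \<gamma> s))"

definition lq_cost :: "real^'n::finite^'n::finite \<Rightarrow> real^'m::finite^'n::finite \<Rightarrow> real^'n::finite^'n::finite \<Rightarrow> real \<Rightarrow> real^'n::finite \<Rightarrow> real^'n::finite \<Rightarrow> ereal" where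
  "lq_cost A B Q T x y = Inf {ereal (action Q T \<gamma> u) | \<gamma> u.
       admissible A B T \<gamma> u \<and> \<gamma> 0 = x \<and> \<gamma> T = y}"

end

theory Submission
  imports Defs
begin

text \<open>Let \<^term>\<open>S\<close> be the matrix \<open>R\<^sub>1 R\<^sub>3\<^sup>-\<^sup>1\<close>, which solves the Riccati equation of the problem wherever
  \<open>R\<^sub>3\<close> is invertible. As there are no conjugate times in \<open>(0, T]\<close>, \<open>R\<^sub>3(t + d)\<close> is invertible for all
  \<open>t\<close> in \<open>[0, T]\<close> when \<open>d > 0\<close> is small; shifting time by \<open>d\<close> moves the singularity of \<open>S\<close> at \<open>0\<close>
  out of the interval. Completing the square with the shifted \<open>S\<close> along the difference of an
  admissible trajectory and the extremal \<open>(p, x)\<close> with the same endpoints shows that the extremal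
  is optimal. Its action is half the increment of \<open>p \<bullet> x\<close>, which the flow expresses through the
  endpoints. For trajectories with square integrable controls the product rule comes from
  Fubini's theorem.\<close>

section \<open>Bilinearity of matrix products and the derivative of the matrix exponential\<close>

lemma bounded_bilinear_matrix_vector_mult:
  "bounded_bilinear ((*v) :: real^'n^'m \<Rightarrow> real^'n \<Rightarrow> real^'m)"
  unfolding bilinear_conv_bounded_bilinear[symmetric] bilinear_def
  by (auto intro!: linearI simp: matrix_vector_mult_add_rdistrib scaleR_matrix_vector_assoc)

lemma bounded_bilinear_matrix_matrix_mult:
  "bounded_bilinear ((**) :: real^'n^'m \<Rightarrow> real^'k^'n \<Rightarrow> real^'k^'m)"
  unfolding bilinear_conv_bounded_bilinear[symmetric] bilinear_def
  by (auto intro!: linearI simp: matrix_matrix_mult_def vec_eq_iff sum.distrib algebra_simps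
      sum_distrib_left)

lemmas bounded_linear_matrix_mult_left =
  bounded_bilinear.bounded_linear_right[OF bounded_bilinear_matrix_matrix_mult]

text \<open>The inner product with a basis vector turns this into a real power series, for which
  termwise differentiation is classical. The second summability assumption lets the inner product
  pass through the differentiated series.\<close>

lemma has_vector_derivative_power_series:
  fixes c :: "nat \<Rightarrow> 'a::euclidean_space"
  assumes "\<And>t::real. summable (\<lambda>n. t ^ n *\<^sub>R c n)"
    and "\<And>t::real. summable (\<lambda>n. t ^ n *\<^sub>R (real (Suc n) *\<^sub>R c (Suc n)))"
  shows "((\<lambda>t. \<Sum>n. t ^ n *\<^sub>R c n) has_vector_derivative
           (\<Sum>n. t ^ n *\<^sub>R (real (Suc n) *\<^sub>R c (Suc n)))) (at t)"
  unfolding has_vector_derivative_def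
proof (subst has_derivative_componentwise_within, intro ballI)
  fix b :: 'a assume "b \<in> Basis"
  have inn: "(\<Sum>n. f n) \<bullet> b = (\<Sum>n. f n \<bullet> b)" if "summable f" for f :: "nat \<Rightarrow> 'a"
    using bounded_linear.suminf[OF bounded_linear_inner_left that] by simp
  have "summable (\<lambda>n. (c n \<bullet> b) * y ^ n)" for y :: real
    using bounded_linear.summable[OF bounded_linear_inner_left assms(1)[of y], of b]
    by (simp add: mult.commute)
  then have "((\<lambda>t. \<Sum>n. (c n \<bullet> b) * t ^ n) has_field_derivative
      (\<Sum>n. diffs (\<lambda>n. c n \<bullet> b) n * t ^ n)) (at t)"
    by (rule termdiffs_strong_converges_everywhere)
  moreover have "(\<Sum>n. (c n \<bullet> b) * t ^ n) = (\<Sum>n. t ^ n *\<^sub>R c n) \<bullet> b" for t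
    by (simp add: inn[OF assms(1)] mult.commute)
  moreover have "(\<Sum>n. diffs (\<lambda>n. c n \<bullet> b) n * t ^ n)
      = (\<Sum>n. t ^ n *\<^sub>R (real (Suc n) *\<^sub>R c (Suc n))) \<bullet> b"
    unfolding inn[OF assms(2)] diffs_def
    by (intro suminf_cong) (simp add: algebra_simps)
  ultimately show "((\<lambda>t. (\<Sum>n. t ^ n *\<^sub>R c n) \<bullet> b) has_derivative
      (\<lambda>x. (x *\<^sub>R (\<Sum>n. t ^ n *\<^sub>R (real (Suc n) *\<^sub>R c (Suc n)))) \<bullet> b)) (at t)"
    by (simp add: has_field_derivative_def mult_commute_abs)
qed

lemma mpow_scaleR: "mpow (t *\<^sub>R M) j = t ^ j *\<^sub>R mpow M j"
  for M :: "real^'k::finite^'k"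
proof (induction j)
  case (Suc j)
  then show ?case
    by (simp add: bounded_bilinear.scaleR_left[OF bounded_bilinear_matrix_matrix_mult]
        bounded_bilinear.scaleR_right[OF bounded_bilinear_matrix_matrix_mult])
qed simp

text \<open>\<open>K\<close> bounds the linear map taking \<open>N\<close> to \<open>M ** N\<close>,
  and each step of \<open>mpow\<close> applies that map once. The factor in front is the norm of the
  zeroth power, which need not be 1 for the Euclidean norm of matrices.\<close>

lemma norm_mpow_le:
  fixes M :: "real^'k::finite^'k"
  obtains K where "K \<ge> 0" "\<And>j. norm (mpow M j) \<le> norm (mat 1 :: real^'k^'k) * K ^ j"
proof -
  obtain K where K: "K \<ge> 0" "\<And>N :: real^'k^'k. norm (M ** N) \<le> norm N * K"
    using bounded_linear.nonneg_bounded[OF bounded_linear_matrix_mult_left[of M]] by blast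
  have "norm (mpow M j) \<le> norm (mat 1 :: real^'k^'k) * K ^ j" for j
  proof (induction j)
    case (Suc j)
    have "norm (mpow M (Suc j)) \<le> norm (mpow M j) * K"
      using K(2) by simp
    also have "\<dots> \<le> norm (mat 1 :: real^'k^'k) * K ^ j * K"
      using Suc K(1) by (intro mult_right_mono)
    finally show ?case by (simp add: mult_ac)
  qed simp
  with K(1) show thesis by (rule that)
qed

lemma summable_mexp: "summable (\<lambda>j. t ^ j *\<^sub>R ((1 / fact j) *\<^sub>R mpow M j))"
  for M :: "real^'k::finite^'k"
proof -
  obtain K where K: "K \<ge> 0" "\<And>j. norm (mpow M j) \<le> norm (mat 1 :: real^'k^'k) * K ^ j"
    using norm_mpow_le[of M] by blast
  have "summable (\<lambda>j. norm (mat 1 :: real^'k^'k) * (inverse (fact j) * (\<bar>t\<bar> * K) ^ j))"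
    by (intro summable_mult summable_exp)
  moreover have "norm (t ^ j *\<^sub>R ((1 / fact j) *\<^sub>R mpow M j))
      \<le> norm (mat 1 :: real^'k^'k) * (inverse (fact j) * (\<bar>t\<bar> * K) ^ j)" for j
  proof -
    have "norm (t ^ j *\<^sub>R ((1 / fact j) *\<^sub>R mpow M j)) = \<bar>t\<bar> ^ j / fact j * norm (mpow M j)"
      by (simp add: power_abs)
    also have "\<dots> \<le> \<bar>t\<bar> ^ j / fact j * (norm (mat 1 :: real^'k^'k) * K ^ j)"
      by (intro mult_left_mono K) simp
    finally show ?thesis by (simp add: field_simps power_mult_distrib)
  qed
  ultimately show ?thesis by (rule summable_comparison_test'[where N=0, simplified])
qed

lemma mexp_scaleR: "mexp (t *\<^sub>R M) = (\<Sum>j. t ^ j *\<^sub>R ((1 / fact j) *\<^sub>R mpow M j))"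
  for M :: "real^'k::finite^'k"
  by (simp add: mexp_def mpow_scaleR mult.commute)

lemma mexp_0: "mexp (0 :: real^'k::finite^'k) = mat 1"
proof -
  have "mpow (0 :: real^'k^'k) j = (if j = 0 then mat 1 else 0)" for j
    by (cases j) (simp_all add: bounded_bilinear.zero_left[OF bounded_bilinear_matrix_matrix_mult])
  then have "mexp (0 :: real^'k^'k) = (\<Sum>j. if j = 0 then mat 1 else 0)"
    unfolding mexp_def by (intro suminf_cong) simp
  then show ?thesis
    using suminf_finite[of "{0::nat}" "\<lambda>j. if j = 0 then mat 1 else (0 :: real^'k^'k)"] by simp
qed

text \<open>The factor \<open>Suc j\<close> cancels against the factorial, so the differentiated
  series is \<open>M\<close> times the original one; its summability follows as well.\<close>

lemma has_vector_derivative_mexp: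
  fixes M :: "real^'k::finite^'k"
  shows "((\<lambda>t. mexp (t *\<^sub>R M)) has_vector_derivative M ** mexp (t *\<^sub>R M)) (at t)"
proof -
  define c where "c j = (1 / fact j) *\<^sub>R mpow M j" for j
  have sm: "summable (\<lambda>j. t ^ j *\<^sub>R c j)" for t
    unfolding c_def by (rule summable_mexp)
  have "t ^ j *\<^sub>R (real (Suc j) *\<^sub>R c (Suc j)) = M ** (t ^ j *\<^sub>R c j)" for t j
    by (simp add: c_def bounded_bilinear.scaleR_right[OF bounded_bilinear_matrix_matrix_mult]
        divide_simps del: of_nat_Suc)
  then have *: "(\<lambda>j. t ^ j *\<^sub>R (real (Suc j) *\<^sub>R c (Suc j))) = (\<lambda>j. M ** (t ^ j *\<^sub>R c j))" for t
    by blast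
  have sm': "summable (\<lambda>j. t ^ j *\<^sub>R (real (Suc j) *\<^sub>R c (Suc j)))" for t
    unfolding * by (rule bounded_linear.summable[OF bounded_linear_matrix_mult_left sm])
  show ?thesis
    using has_vector_derivative_power_series[OF sm sm', of t]
      bounded_linear.suminf[OF bounded_linear_matrix_mult_left sm, of M t]
    unfolding mexp_scaleR c_def[symmetric] * by simp
qed

section \<open>Absolutely continuous functions and their product rule\<close>

text \<open>Absolute continuity with density \<open>f'\<close>, phrased through the same kind of
  integral equation as \<open>admissible\<close>, so that almost everywhere derivatives never have
  to be taken.\<close>

definition ac_on :: "real \<Rightarrow> (real \<Rightarrow> 'a::euclidean_space) \<Rightarrow> (real \<Rightarrow> 'a) \<Rightarrow> bool" where
  "ac_on T f f' \<longleftrightarrow> set_integrable lborel {0..T} f' \<and>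
     (\<forall>t\<in>{0..T}. f t = f 0 + (LINT s:{0..t}|lborel. f' s))"

lemma ac_on_integrable: "ac_on T f f' \<Longrightarrow> set_integrable lborel {0..T} f'"
  and ac_on_eq: "ac_on T f f' \<Longrightarrow> t \<in> {0..T} \<Longrightarrow> f t = f 0 + (LINT s:{0..t}|lborel. f' s)"
  unfolding ac_on_def by blast+

text \<open>On each \<open>{0..t}\<close> the Lebesgue integral agrees with the gauge integral,
  which is continuous in its upper limit.\<close>

lemma ac_on_continuous:
  assumes "ac_on T f f'"
  shows "continuous_on {0..T} f"
proof -
  have i: "set_integrable lborel {0..t} f'" if "t \<le> T" for t
    using set_integrable_subset[OF ac_on_integrable[OF assms]] that by simp
  have "continuous_on {0..T} (\<lambda>t. f 0 + integral {0..t} f')"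
    by (intro continuous_intros indefinite_integral_continuous_1
        set_borel_integral_eq_integral(1)[OF i]) simp
  moreover have "f 0 + integral {0..t} f' = f t" if "t \<in> {0..T}" for t
    using ac_on_eq[OF assms that] set_borel_integral_eq_integral(2)[OF i, of t] that by simp
  ultimately show ?thesis
    by (rule continuous_on_eq)
qed

lemma ac_on_subset:
  assumes "ac_on T f f'" "t \<le> T"
  shows "ac_on t f f'"
  unfolding ac_on_def
proof (intro conjI ballI)
  show "set_integrable lborel {0..t} f'"
    using set_integrable_subset[OF ac_on_integrable[OF assms(1)]] assms(2) by simp
  show "f s = f 0 + (LINT s:{0..s}|lborel. f' s)" if "s \<in> {0..t}" for s
    by (rule ac_on_eq[OF assms(1)]) (use that assms(2) in auto)
qed

lemma ac_on_add:
  assumes "ac_on T f f'" "ac_on T g g'"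
  shows "ac_on T (\<lambda>t. f t + g t) (\<lambda>t. f' t + g' t)"
  unfolding ac_on_def
proof (intro conjI ballI)
  show "set_integrable lborel {0..T} (\<lambda>t. f' t + g' t)"
    using assms by (intro set_integral_add(1) ac_on_integrable)
  fix t assume t: "t \<in> {0..T}"
  then have "set_integrable lborel {0..t} f'" "set_integrable lborel {0..t} g'"
    using assms[THEN ac_on_subset, THEN ac_on_integrable, of t] by simp_all
  then have "(LINT s:{0..t}|lborel. f' s + g' s)
      = (LINT s:{0..t}|lborel. f' s) + (LINT s:{0..t}|lborel. g' s)"
    by (rule set_integral_add(2))
  then show "f t + g t = f 0 + g 0 + (LINT s:{0..t}|lborel. f' s + g' s)"
    by (subst (1) ac_on_eq[OF assms(1) t], subst (1) ac_on_eq[OF assms(2) t]) simp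
qed

lemma ac_on_bounded_linear:
  fixes h :: "'a::euclidean_space \<Rightarrow> 'b::euclidean_space"
  assumes h: "bounded_linear h" and f: "ac_on T f f'"
  shows "ac_on T (\<lambda>t. h (f t)) (\<lambda>t. h (f' t))"
proof -
  interpret bounded_linear h by (rule h)
  have h_int: "set_integrable lborel {0..t} (\<lambda>s. h (f' s))
      \<and> (LINT s:{0..t}|lborel. h (f' s)) = h (LINT s:{0..t}|lborel. f' s)" if "t \<le> T" for t
    using integrable_bounded_linear[OF h ac_on_integrable[OF ac_on_subset[OF f that],
          unfolded set_integrable_def]]
      integral_bounded_linear[OF h ac_on_integrable[OF ac_on_subset[OF f that],
          unfolded set_integrable_def]]
    by (simp add: set_integrable_def set_lebesgue_integral_def scaleR)
  show ?thesis
    unfolding ac_on_def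
  proof (intro conjI ballI)
    show "set_integrable lborel {0..T} (\<lambda>s. h (f' s))" using h_int by simp
    fix t assume t: "t \<in> {0..T}"
    then show "h (f t) = h (f 0) + (LINT s:{0..t}|lborel. h (f' s))"
      using ac_on_eq[OF f t] h_int[of t] by (metis add atLeastAtMost_iff)
  qed
qed

lemmas ac_on_cmult = ac_on_bounded_linear[OF bounded_linear_mult_right]

lemma ac_on_diff:
  assumes "ac_on T f f'" "ac_on T g g'"
  shows "ac_on T (\<lambda>t. f t - g t) (\<lambda>t. f' t - g' t)"
  using ac_on_add[OF assms(1) ac_on_bounded_linear[OF bounded_linear_minus[OF bounded_linear_ident] assms(2)]]
  by simp

lemma ac_on_C1:
  fixes f :: "real \<Rightarrow> 'a::euclidean_space"
  assumes "\<And>t. t \<in> {0..T} \<Longrightarrow> (f has_vector_derivative f' t) (at t)"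
    and "continuous_on {0..T} f'"
  shows "ac_on T f f'"
  unfolding ac_on_def
proof (intro conjI ballI)
  show "set_integrable lborel {0..T} f'"
    by (rule borel_integrable_atLeastAtMost'[OF assms(2)])
  fix t assume "t \<in> {0..T}"
  then have "(LINT s:{0..t}|lborel. f' s) = f t - f 0"
    unfolding set_lebesgue_integral_def
    by (intro integral_FTC_atLeastAtMost)
      (auto intro: continuous_on_subset[OF assms(2)] has_vector_derivative_at_within[OF assms(1)])
  then show "f t = f 0 + (LINT s:{0..t}|lborel. f' s)" by simp
qed

lemma borel_measurable_bilinear:
  fixes h :: "'a::euclidean_space \<Rightarrow> 'b::euclidean_space \<Rightarrow> 'c::euclidean_space"
  assumes h: "bounded_bilinear h"
    and "f \<in> borel_measurable M" "g \<in> borel_measurable M"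
  shows "(\<lambda>x. h (f x) (g x)) \<in> borel_measurable M"
  using assms(2,3)
  by (rule borel_measurable_continuous_Pair)
    (intro bounded_bilinear.continuous_on[OF h] continuous_intros)

text \<open>\<open>g\<close> is bounded on the compact interval, so a constant multiple of
  \<open>f\<close> dominates the integrand.\<close>

lemma set_integrable_bilinear_continuous_right:
  fixes h :: "'a::euclidean_space \<Rightarrow> 'b::euclidean_space \<Rightarrow> 'c::euclidean_space"
  assumes h: "bounded_bilinear h"
    and f: "set_integrable lborel {0..T::real} f" and g: "continuous_on {0..T} g"
  shows "set_integrable lborel {0..T} (\<lambda>t. h (f t) (g t))"
proof -
  interpret bounded_bilinear h by (rule h)
  obtain K where K: "K \<ge> 0" "\<And>a b. norm (h a b) \<le> norm a * norm b * K"
    using nonneg_bounded by blast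
  have "bounded (g ` {0..T})"
    by (intro compact_imp_bounded compact_continuous_image g compact_Icc)
  then obtain C where C: "\<And>t. t \<in> {0..T} \<Longrightarrow> norm (g t) \<le> C"
    unfolding bounded_iff by blast
  let ?f = "\<lambda>t. indicator {0..T} t *\<^sub>R f t" and ?g = "\<lambda>t. indicator {0..T} t *\<^sub>R g t"
  have i: "integrable lborel ?f"
    using f by (simp add: set_integrable_def)
  have "integrable lborel (\<lambda>t. (K * C) *\<^sub>R ?f t)"
    by (intro integrable_scaleR_right i)
  moreover have "?g \<in> borel_measurable lborel"
    using borel_measurable_continuous_on_indicator[OF _ g] by simp
  then have "(\<lambda>t. h (?f t) (?g t)) \<in> borel_measurable lborel"
    using i by (intro borel_measurable_bilinear[OF h]) auto
  moreover have "norm (h (?f t) (?g t)) \<le> norm ((K * C) *\<^sub>R ?f t)" for t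
  proof (cases "t \<in> {0..T}")
    case True
    have "norm (h (f t) (g t)) \<le> norm (f t) * norm (g t) * K" by (rule K)
    also have "\<dots> \<le> norm (f t) * C * K"
      using C[OF True] K(1) by (intro mult_right_mono mult_left_mono) auto
    also have "\<dots> \<le> \<bar>K * C\<bar> * norm (f t)"
      by (metis abs_ge_self mult.commute mult.assoc mult_right_mono norm_ge_zero)
    finally show ?thesis using True by simp
  qed (simp add: zero_left)
  ultimately have "integrable lborel (\<lambda>t. h (?f t) (?g t))"
    by (rule Bochner_Integration.integrable_bound[OF _ _ AE_I2])
  moreover have "h (?f t) (?g t) = indicator {0..T} t *\<^sub>R h (f t) (g t)" for t
    by (simp add: indicator_def zero_left)
  ultimately show ?thesis by (simp add: set_integrable_def)
qed

context
  fixes h :: "'a::euclidean_space \<Rightarrow> 'b::euclidean_space \<Rightarrow> 'c::euclidean_space"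
  assumes h: "bounded_bilinear h"
begin

text \<open>The integrand is dominated by a multiple of the product of the two norms, whose iterated
  integrals are finite. This is the integrability that Fubini's theorem asks for.\<close>

lemma integrable_pair_bilinear:
  fixes a :: "real \<Rightarrow> 'a" and b :: "real \<Rightarrow> 'b"
  assumes a: "integrable lborel a" and b: "integrable lborel b"
  shows "integrable (lborel \<Otimes>\<^sub>M lborel) (\<lambda>(r, s). h (a r) (b s))"
proof -
  interpret bounded_bilinear h by (rule h)
  obtain K where K: "K \<ge> 0" "\<And>a b. norm (h a b) \<le> norm a * norm b * K"
    using nonneg_bounded by blast
  have "integrable (lborel \<Otimes>\<^sub>M lborel) (\<lambda>(r, s). norm (a r) * norm (b s))"
  proof (rule lborel_pair.Fubini_integrable)
    show "(\<lambda>(r, s). norm (a r) * norm (b s)) \<in> borel_measurable (lborel \<Otimes>\<^sub>M lborel)"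
      using a b by measurable
    show "integrable lborel (\<lambda>x. LINT y|lborel. norm (case (x, y) of (r, s) \<Rightarrow> norm (a r) * norm (b s)))"
      using a b by simp
    show "AE x in lborel. integrable lborel (\<lambda>y. case (x, y) of (r, s) \<Rightarrow> norm (a r) * norm (b s))"
      using b by simp
  qed
  then have "integrable (lborel \<Otimes>\<^sub>M lborel) (\<lambda>p. K * (case p of (r, s) \<Rightarrow> norm (a r) * norm (b s)))"
    by simp
  moreover have "(\<lambda>(r, s). h (a r) (b s)) \<in> borel_measurable (lborel \<Otimes>\<^sub>M lborel)"
    unfolding case_prod_unfold
    by (intro borel_measurable_bilinear[OF h] measurable_compose[OF measurable_fst]
        measurable_compose[OF measurable_snd] borel_measurable_integrable a b)
  ultimately show ?thesis
    by (rule Bochner_Integration.integrable_bound)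
      (use K in \<open>auto simp: case_prod_unfold mult_ac abs_mult intro!: AE_I2\<close>)
qed

text \<open>Both iterated integrals are integrals of \<^term>\<open>h (a r) (b s)\<close> over one of the two triangles
  cut out of the plane by the diagonal, which is a null set.\<close>

lemma integral_bilinear_triangles:
  fixes a :: "real \<Rightarrow> 'a" and b :: "real \<Rightarrow> 'b"
  assumes a: "integrable lborel a" and b: "integrable lborel b"
  shows "(LINT s|lborel. h (LINT r|lborel. indicator {..s} r *\<^sub>R a r) (b s))
       + (LINT r|lborel. h (a r) (LINT s|lborel. indicator {..r} s *\<^sub>R b s))
       = h (integral\<^sup>L lborel a) (integral\<^sup>L lborel b)"
proof -
  interpret bounded_bilinear h by (rule h)
  have ia: "integrable lborel (\<lambda>r. indicator {..s} r *\<^sub>R a r)" for s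
    using a by (intro integrable_mult_indicator) auto
  have ib: "integrable lborel (\<lambda>r. indicator {..s} r *\<^sub>R b r)" for s
    using b by (intro integrable_mult_indicator) auto
  have hl: "h (integral\<^sup>L lborel f) y = (LINT r|lborel. h (f r) y)"
    if "integrable lborel f" for f :: "real \<Rightarrow> 'a" and y
    using integral_bounded_linear[OF bounded_linear_left that] by simp
  have hr: "h x (integral\<^sup>L lborel f) = (LINT r|lborel. h x (f r))"
    if "integrable lborel f" for f :: "real \<Rightarrow> 'b" and x
    using integral_bounded_linear[OF bounded_linear_right that] by simp
  note K = integrable_pair_bilinear[OF a b]
  have K1: "integrable (lborel \<Otimes>\<^sub>M lborel) (\<lambda>(r, s). indicator {..s} r *\<^sub>R h (a r) (b s))"
  proof -
    have "{p \<in> space (lborel \<Otimes>\<^sub>M lborel). fst p \<le> (snd p :: real)} \<in> sets (lborel \<Otimes>\<^sub>M lborel)"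
      by measurable
    from integrable_mult_indicator[OF this K] show ?thesis
      by (rule back_subst[of "integrable _"]) (auto simp: indicator_def space_pair_measure)
  qed
  have K2: "integrable (lborel \<Otimes>\<^sub>M lborel) (\<lambda>(r, s). indicator {..r} s *\<^sub>R h (a r) (b s))"
  proof -
    have "{p \<in> space (lborel \<Otimes>\<^sub>M lborel). snd p \<le> (fst p :: real)} \<in> sets (lborel \<Otimes>\<^sub>M lborel)"
      by measurable
    from integrable_mult_indicator[OF this K] show ?thesis
      by (rule back_subst[of "integrable _"]) (auto simp: indicator_def space_pair_measure)
  qed
  have i1: "integrable lborel (\<lambda>r. indicator {..s} r *\<^sub>R h (a r) (b s))" for s
    using integrable_bounded_linear[OF bounded_linear_left ia, of s "b s"]
    by (simp add: scaleR_left)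
  \<comment> \<open>As a function of \<open>r\<close> with \<open>s\<close> fixed, the indicator of
    \<open>{..r}\<close> at \<open>s\<close> is the indicator of \<open>{s..}\<close> at
    \<open>r\<close>.\<close>
  have i2: "integrable lborel (\<lambda>r. indicator {..r} s *\<^sub>R h (a r) (b s))" for s
  proof -
    have "integrable lborel (\<lambda>r. indicator {s..} r *\<^sub>R h (a r) (b s))"
      using integrable_bounded_linear[OF bounded_linear_left a, of "b s"]
      by (intro integrable_mult_indicator) auto
    then show ?thesis
      by (rule back_subst[of "integrable _"]) (auto simp: indicator_def)
  qed
  have "(LINT s|lborel. h (LINT r|lborel. indicator {..s} r *\<^sub>R a r) (b s))
      = (LINT s|lborel. LINT r|lborel. indicator {..s} r *\<^sub>R h (a r) (b s))"
    by (simp add: hl[OF ia] scaleR_left)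
  \<comment> \<open>Fubini exchanges the order here, so that both double integrals have
    \<open>r\<close> as inner variable and can be added under the outer integral.\<close>
  moreover have "(LINT r|lborel. h (a r) (LINT s|lborel. indicator {..r} s *\<^sub>R b s))
      = (LINT s|lborel. LINT r|lborel. indicator {..r} s *\<^sub>R h (a r) (b s))"
    by (simp add: hr[OF ib] scaleR_right lborel_pair.Fubini_integral[OF K2])
  moreover have "(LINT s|lborel. LINT r|lborel. indicator {..s} r *\<^sub>R h (a r) (b s))
        + (LINT s|lborel. LINT r|lborel. indicator {..r} s *\<^sub>R h (a r) (b s))
      = (LINT s|lborel. (LINT r|lborel. indicator {..s} r *\<^sub>R h (a r) (b s))
        + (LINT r|lborel. indicator {..r} s *\<^sub>R h (a r) (b s)))"
    using lborel_pair.integrable_snd[OF K1] lborel_pair.integrable_snd[OF K2] by simp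
  moreover have "(LINT r|lborel. indicator {..s} r *\<^sub>R h (a r) (b s))
        + (LINT r|lborel. indicator {..r} s *\<^sub>R h (a r) (b s)) = h (integral\<^sup>L lborel a) (b s)" for s
  proof -
    have "(LINT r|lborel. indicator {..s} r *\<^sub>R h (a r) (b s))
        + (LINT r|lborel. indicator {..r} s *\<^sub>R h (a r) (b s))
        = (LINT r|lborel. indicator {..s} r *\<^sub>R h (a r) (b s) + indicator {..r} s *\<^sub>R h (a r) (b s))"
      using i1 i2 by simp
    also have "\<dots> = (LINT r|lborel. h (a r) (b s))"
    proof (rule integral_cong_AE)
      show "AE r in lborel. indicator {..s} r *\<^sub>R h (a r) (b s)
          + indicator {..r} s *\<^sub>R h (a r) (b s) = h (a r) (b s)"
        using AE_lborel_singleton[of s] by eventually_elim (auto simp: indicator_def)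
      show "(\<lambda>r. indicator {..s} r *\<^sub>R h (a r) (b s) + indicator {..r} s *\<^sub>R h (a r) (b s))
          \<in> borel_measurable lborel"
        using i1 i2 by (intro borel_measurable_add) auto
      show "(\<lambda>r. h (a r) (b s)) \<in> borel_measurable lborel"
        using integrable_bounded_linear[OF bounded_linear_left a] by auto
    qed
    finally show ?thesis by (simp add: hl[OF a])
  qed
  ultimately show ?thesis by (simp add: hr[OF b])
qed

text \<open>With \<open>a\<close> and \<open>b\<close> the densities cut off to
  \<open>{0..t}\<close>, each of \<open>f s\<close> and \<open>g s\<close> is its initial value plus
  an integral up to \<open>s\<close>. The initial values give the terms of
  \<open>h (f t) (g t)\<close> that are linear in one integral; the two mixed terms add up to
  \<open>h\<close> of both integrals by \<open>integral_bilinear_triangles\<close>.\<close>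

lemma ac_on_bilinear:
  assumes f: "ac_on T f f'" and g: "ac_on T g g'"
  shows "ac_on T (\<lambda>t. h (f t) (g t)) (\<lambda>t. h (f' t) (g t) + h (f t) (g' t))"
proof -
  interpret bounded_bilinear h by (rule h)
  have intl: "set_integrable lborel {0..t} (\<lambda>t. h (f' t) (g t))"
    and intr: "set_integrable lborel {0..t} (\<lambda>t. h (f t) (g' t))" if "t \<le> T" for t
    using ac_on_subset[OF f that] ac_on_subset[OF g that]
    by (auto intro: set_integrable_bilinear_continuous_right[OF h]
        set_integrable_bilinear_continuous_right[OF flip] ac_on_integrable ac_on_continuous)
  show ?thesis
    unfolding ac_on_def
  proof (intro conjI ballI)
    show "set_integrable lborel {0..T} (\<lambda>t. h (f' t) (g t) + h (f t) (g' t))"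
      using intl intr by (intro set_integral_add(1)) auto
    fix t assume t: "t \<in> {0..T}"
    then have tT: "t \<le> T" by simp
    define a where "a s = indicator {0..t} s *\<^sub>R f' s" for s
    define b where "b s = indicator {0..t} s *\<^sub>R g' s" for s
    have a: "integrable lborel a" and b: "integrable lborel b"
      using ac_on_integrable[OF ac_on_subset[OF f]] ac_on_integrable[OF ac_on_subset[OF g]] t
      by (auto simp: a_def[abs_def] b_def[abs_def] set_integrable_def)
    have ft: "f t = f 0 + integral\<^sup>L lborel a" and gt: "g t = g 0 + integral\<^sup>L lborel b"
      using ac_on_eq[OF f t] ac_on_eq[OF g t]
      by (simp_all add: a_def[abs_def] b_def[abs_def] set_lebesgue_integral_def)
    have fs: "f s = f 0 + (LINT r|lborel. indicator {..s} r *\<^sub>R a r)"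
      and gs: "g s = g 0 + (LINT r|lborel. indicator {..s} r *\<^sub>R b r)" if "s \<in> {0..t}" for s
    proof -
      have "indicator {0..s} r = (indicator {..s} r * indicator {0..t} r :: real)" for r
        using that by (auto simp: indicator_def)
      then show "f s = f 0 + (LINT r|lborel. indicator {..s} r *\<^sub>R a r)"
        "g s = g 0 + (LINT r|lborel. indicator {..s} r *\<^sub>R b r)"
        using ac_on_eq[OF f, of s] ac_on_eq[OF g, of s] t that
        by (simp_all add: a_def[abs_def] b_def[abs_def] set_lebesgue_integral_def)
    qed
    have el: "indicator {0..t} s *\<^sub>R h (f' s) (g s)
        = h (a s) (g 0) + h (a s) (LINT r|lborel. indicator {..s} r *\<^sub>R b r)" for s
      using gs[of s] by (cases "s \<in> {0..t}") (auto simp: a_def zero_left add_right)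
    have er: "indicator {0..t} s *\<^sub>R h (f s) (g' s)
        = h (f 0) (b s) + h (LINT r|lborel. indicator {..s} r *\<^sub>R a r) (b s)" for s
      using fs[of s] by (cases "s \<in> {0..t}") (auto simp: b_def zero_right add_left)
    have i0: "integrable lborel (\<lambda>s. h (a s) (g 0))" "integrable lborel (\<lambda>s. h (f 0) (b s))"
      using integrable_bounded_linear[OF bounded_linear_left a]
        integrable_bounded_linear[OF bounded_linear_right b] by auto
    \<comment> \<open>Integrability of a mixed term comes by subtraction in the expansion
      \<open>el\<close>, since the whole and the term with the initial value are known to be
      integrable.\<close>
    have i1: "integrable lborel (\<lambda>s. h (a s) (LINT r|lborel. indicator {..s} r *\<^sub>R b r))"
      using Bochner_Integration.integrable_diff[OF intl[OF tT, unfolded set_integrable_def el] i0(1)]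
      by simp
    have i2: "integrable lborel (\<lambda>s. h (LINT r|lborel. indicator {..s} r *\<^sub>R a r) (b s))"
      using Bochner_Integration.integrable_diff[OF intr[OF tT, unfolded set_integrable_def er] i0(2)]
      by simp
    have "(LINT s:{0..t}|lborel. h (f' s) (g s) + h (f s) (g' s))
        = (LINT s:{0..t}|lborel. h (f' s) (g s)) + (LINT s:{0..t}|lborel. h (f s) (g' s))"
      by (rule set_integral_add(2)[OF intl[OF tT] intr[OF tT]])
    also have "(LINT s:{0..t}|lborel. h (f' s) (g s))
        = h (integral\<^sup>L lborel a) (g 0)
          + (LINT s|lborel. h (a s) (LINT r|lborel. indicator {..s} r *\<^sub>R b r))"
      unfolding set_lebesgue_integral_def el
      using i0 i1 integral_bounded_linear[OF bounded_linear_left a] by simp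
    also have "(LINT s:{0..t}|lborel. h (f s) (g' s))
        = h (f 0) (integral\<^sup>L lborel b)
          + (LINT s|lborel. h (LINT r|lborel. indicator {..s} r *\<^sub>R a r) (b s))"
      unfolding set_lebesgue_integral_def er
      using i0 i2 integral_bounded_linear[OF bounded_linear_right b] by simp
    finally show "h (f t) (g t) = h (f 0) (g 0) + (LINT s:{0..t}|lborel. h (f' s) (g s) + h (f s) (g' s))"
      using integral_bilinear_triangles[OF a b] by (simp add: ft gt add_left add_right algebra_simps)
  qed
qed

end

section \<open>Continuity and derivative of the matrix inverse\<close>

lemma matrix_inv_right_left:
  fixes M :: "real^'n^'n"
  assumes "det M \<noteq> 0"
  shows matrix_inv_right: "M ** matrix_inv M = mat 1"
    and matrix_inv_left: "matrix_inv M ** M = mat 1"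
proof -
  have "\<exists>N. M ** N = mat 1 \<and> N ** M = mat 1"
    using assms by (simp add: invertible_det_nz[symmetric] invertible_def)
  then have "M ** matrix_inv M = mat 1 \<and> matrix_inv M ** M = mat 1"
    unfolding matrix_inv_def by (rule someI_ex)
  then show "M ** matrix_inv M = mat 1" "matrix_inv M ** M = mat 1" by auto
qed

lemma matrix_inv_mult_vector:
  fixes M :: "real^'n^'n"
  assumes "det M \<noteq> 0"
  shows "M *v (matrix_inv M *v v) = v" "matrix_inv M *v (M *v v) = v"
  by (simp_all add: matrix_vector_mul_assoc matrix_inv_right_left[OF assms])

text \<open>Column \<open>j\<close> of the inverse solves a linear system with right-hand side
  \<open>axis j 1\<close>, so Cramer's rule applies. Entries become quotients of determinants, which
  makes continuity visible.\<close>

lemma matrix_inv_nth: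
  fixes M :: "real^'n^'n"
  assumes "det M \<noteq> 0"
  shows "matrix_inv M $ k $ j = det (\<chi> a b. if b = k then axis j 1 $ a else M $ a $ b) / det M"
proof -
  have "M *v (matrix_inv M *v axis j 1) = axis j 1"
    by (rule matrix_inv_mult_vector[OF assms])
  then have "matrix_inv M *v axis j 1
      = (\<chi> k. det (\<chi> a b. if b = k then axis j 1 $ a else M $ a $ b) / det M)"
    by (simp only: cramer[OF assms])
  then have "(matrix_inv M *v axis j 1) $ k
      = det (\<chi> a b. if b = k then axis j 1 $ a else M $ a $ b) / det M"
    by simp
  then show ?thesis by (simp add: matrix_vector_mult_basis column_def)
qed

lemma tendsto_det:
  fixes f :: "'a \<Rightarrow> real^'n^'n"
  assumes "(f \<longlongrightarrow> L) F"
  shows "((\<lambda>x. det (f x)) \<longlongrightarrow> det L) F"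
  unfolding det_def by (intro tendsto_intros assms)

lemma tendsto_matrix_inv:
  fixes f :: "'a \<Rightarrow> real^'n^'n"
  assumes f: "(f \<longlongrightarrow> L) F" and L: "det L \<noteq> 0"
  shows "((\<lambda>x. matrix_inv (f x)) \<longlongrightarrow> matrix_inv L) F"
proof (intro vec_tendstoI)
  fix k j
  \<comment> \<open>The quotient formula is valid only at invertible matrices; near the limit these
    are the only ones that occur.\<close>
  have ev: "eventually (\<lambda>x. det (f x) \<noteq> 0) F"
    using tendsto_imp_eventually_ne[OF tendsto_det[OF f] L] .
  have "((\<lambda>x. det (\<chi> a b. if b = k then axis j 1 $ a else f x $ a $ b) / det (f x)) \<longlongrightarrow>
      det (\<chi> a b. if b = k then axis j 1 $ a else L $ a $ b) / det L) F"
    by (intro tendsto_divide tendsto_det vec_tendstoI f L)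
      (auto intro!: tendsto_intros tendsto_vec_nth f)
  then show "((\<lambda>x. matrix_inv (f x) $ k $ j) \<longlongrightarrow> matrix_inv L $ k $ j) F"
    unfolding matrix_inv_nth[OF L]
    by (rule Lim_transform_eventually) (use ev in eventually_elim, simp add: matrix_inv_nth)
qed

lemma has_vector_derivative_iff_quotient:
  "(f has_vector_derivative D) (at t) \<longleftrightarrow> ((\<lambda>s. (f s - f t) /\<^sub>R (s - t)) \<longlongrightarrow> D) (at t)"
proof -
  have "(f has_vector_derivative D) (at t) \<longleftrightarrow>
      ((\<lambda>s. norm ((1 / norm (s - t)) *\<^sub>R (f s - (f t + (s - t) *\<^sub>R D)))) \<longlongrightarrow> 0) (at t)"
    by (simp only: has_vector_derivative_def has_derivative_within bounded_linear_scaleR_left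
        tendsto_norm_zero_iff simp_thms)
  also have "\<dots> \<longleftrightarrow> ((\<lambda>s. norm ((f s - f t) /\<^sub>R (s - t) - D)) \<longlongrightarrow> 0) (at t)"
  proof (intro tendsto_cong eventually_at_filter[THEN iffD2] always_eventually allI impI)
    fix s assume "s \<noteq> t"
    then have "(f s - f t) /\<^sub>R (s - t) - D = (f s - (f t + (s - t) *\<^sub>R D)) /\<^sub>R (s - t)"
      by (simp add: scaleR_diff_right scaleR_add_right)
    then show "norm ((1 / norm (s - t)) *\<^sub>R (f s - (f t + (s - t) *\<^sub>R D)))
        = norm ((f s - f t) /\<^sub>R (s - t) - D)"
      by (simp add: divide_inverse)
  qed
  finally show ?thesis
    by (simp add: tendsto_norm_zero_iff LIM_zero_iff)
qed

text \<open>With \<open>Y\<close> the inverse of \<open>X\<close>, one has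
  \<open>Y s - Y t = - (Y s ** (X s - X t) ** Y t)\<close> as soon as both matrices are invertible.
  Dividing by \<open>s - t\<close> and using continuity of the inverse gives the limit.\<close>

lemma has_vector_derivative_matrix_inv:
  fixes X :: "real \<Rightarrow> real^'n^'n"
  assumes X: "(X has_vector_derivative X') (at t)" and det: "det (X t) \<noteq> 0"
  shows "((\<lambda>s. matrix_inv (X s)) has_vector_derivative
      - (matrix_inv (X t) ** X' ** matrix_inv (X t))) (at t)"
proof -
  interpret mm: bounded_bilinear "(**) :: real^'n^'n \<Rightarrow> real^'n^'n \<Rightarrow> real^'n^'n"
    by (rule bounded_bilinear_matrix_matrix_mult)
  let ?Y = "\<lambda>s. matrix_inv (X s)"
  have X0: "(X \<longlongrightarrow> X t) (at t)"
    using has_vector_derivative_continuous[OF X] by (simp add: continuous_at)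
  have q: "((\<lambda>s. (X s - X t) /\<^sub>R (s - t)) \<longlongrightarrow> X') (at t)"
    using X by (simp only: has_vector_derivative_iff_quotient)
  have "((\<lambda>s. - (?Y s ** ((X s - X t) /\<^sub>R (s - t)) ** ?Y t)) \<longlongrightarrow> - (?Y t ** X' ** ?Y t)) (at t)"
    by (intro tendsto_minus mm.tendsto tendsto_const q tendsto_matrix_inv X0 det)
  moreover have "eventually (\<lambda>s. - (?Y s ** ((X s - X t) /\<^sub>R (s - t)) ** ?Y t)
      = (?Y s - ?Y t) /\<^sub>R (s - t)) (at t)"
    using tendsto_imp_eventually_ne[OF tendsto_det[OF X0] det]
  proof eventually_elim
    fix s assume s: "det (X s) \<noteq> 0"
    have "?Y s ** (X s - X t) ** ?Y t = (?Y s ** X s) ** ?Y t - ?Y s ** (X t ** ?Y t)"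
      by (simp add: mm.diff_left mm.diff_right matrix_mul_assoc)
    also have "\<dots> = ?Y t - ?Y s"
      by (simp add: matrix_inv_right_left s det)
    finally have "- (?Y s ** ((X s - X t) /\<^sub>R (s - t)) ** ?Y t) = - ((?Y t - ?Y s) /\<^sub>R (s - t))"
      by (simp only: mm.scaleR_left mm.scaleR_right)
    then show "- (?Y s ** ((X s - X t) /\<^sub>R (s - t)) ** ?Y t) = (?Y s - ?Y t) /\<^sub>R (s - t)"
      by (simp only: scaleR_minus_right[symmetric] minus_diff_eq)
  qed
  ultimately have "((\<lambda>s. (?Y s - ?Y t) /\<^sub>R (s - t)) \<longlongrightarrow> - (?Y t ** X' ** ?Y t)) (at t)"
    by (rule Lim_transform_eventually)
  then show ?thesis by (simp only: has_vector_derivative_iff_quotient)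
qed

section \<open>Block decomposition of the Hamiltonian flow\<close>

lemma sum_UNIV_Plus:
  "(\<Sum>i\<in>(UNIV :: ('a::finite + 'b::finite) set). f i)
   = (\<Sum>a\<in>UNIV. f (Inl a)) + (\<Sum>b\<in>UNIV. f (Inr b))"
  unfolding UNIV_Plus_UNIV[symmetric] by (subst sum.Plus) simp_all

lemmas blk_defs = blk1_def blk2_def blk3_def blk4_def

lemma blk_block [simp]:
  "blk1 (block M1 M2 M3 M4) = M1" "blk2 (block M1 M2 M3 M4) = M2"
  "blk3 (block M1 M2 M3 M4) = M3" "blk4 (block M1 M2 M3 M4) = M4"
  by (simp_all add: blk_defs block_def vec_eq_iff)

lemma blk_mult:
  "blk1 (M ** N) = blk1 M ** blk1 N + blk2 M ** blk3 N"
  "blk2 (M ** N) = blk1 M ** blk2 N + blk2 M ** blk4 N"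
  "blk3 (M ** N) = blk3 M ** blk1 N + blk4 M ** blk3 N"
  "blk4 (M ** N) = blk3 M ** blk2 N + blk4 M ** blk4 N"
  by (simp_all add: blk_defs matrix_matrix_mult_def vec_eq_iff sum_UNIV_Plus)

lemma blk_uminus:
  "blk1 (- M) = - blk1 M" "blk2 (- M) = - blk2 M"
  "blk3 (- M) = - blk3 M" "blk4 (- M) = - blk4 M"
  by (simp_all add: blk_defs vec_eq_iff)

lemma blk_mat_1:
  "blk1 (mat 1) = mat 1" "blk2 (mat 1) = 0" "blk3 (mat 1) = 0" "blk4 (mat 1) = mat 1"
  by (simp_all add: blk_defs vec_eq_iff mat_def)

lemma bounded_linear_blk:
  "bounded_linear blk1" "bounded_linear blk2" "bounded_linear blk3" "bounded_linear blk4"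
  by (simp_all add: linear_conv_bounded_linear[symmetric] blk_defs vec_eq_iff linearI)

lemma matrix_minus_mult: "(- M) ** N = - (M ** N)" "M ** (- N) = - (M ** N)"
  for M :: "real^'n^'m" and N :: "real^'k^'n"
  by (simp_all add: bounded_bilinear.minus_left[OF bounded_bilinear_matrix_matrix_mult]
      bounded_bilinear.minus_right[OF bounded_bilinear_matrix_matrix_mult])

lemma matrix_minus_mult_vector: "(- M) *v v = - (M *v v)" "M *v (- v) = - (M *v v)"
  for M :: "real^'n^'m"
  by (simp_all add: bounded_bilinear.minus_left[OF bounded_bilinear_matrix_vector_mult]
      bounded_bilinear.minus_right[OF bounded_bilinear_matrix_vector_mult])

lemma matrix_mult_0: "0 ** N = 0" "M ** 0 = 0"
  for M :: "real^'n^'m" and N :: "real^'k^'n"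
  by (simp_all add: bounded_bilinear.zero_left[OF bounded_bilinear_matrix_matrix_mult]
      bounded_bilinear.zero_right[OF bounded_bilinear_matrix_matrix_mult])

lemma flow_eq: "flow A B Q t = mexp (t *\<^sub>R (- (Omega ** Hmat A B Q)))"
  by (simp add: flow_def)

text \<open>These blocks fix the signs and the order of the variables: with the costate first, the
  system is \<open>p' = - A^* p - Q x\<close>, \<open>x' = B B^* p + A x\<close>.\<close>

lemma blk_generator:
  "blk1 (- (Omega ** Hmat A B Q)) = - transpose A"
  "blk2 (- (Omega ** Hmat A B Q)) = - Q"
  "blk3 (- (Omega ** Hmat A B Q)) = B ** transpose B"
  "blk4 (- (Omega ** Hmat A B Q)) = A"
  by (simp_all add: blk_uminus blk_mult Omega_def Hmat_def matrix_minus_mult matrix_mult_0)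

lemma R_has_vector_derivative:
  fixes A :: "real^'n^'n" and B :: "real^'m^'n"
  shows "(R1 A B Q has_vector_derivative - (transpose A ** R1 A B Q t) - Q ** R3 A B Q t) (at t)"
    "(R2 A B Q has_vector_derivative - (transpose A ** R2 A B Q t) - Q ** R4 A B Q t) (at t)"
    "(R3 A B Q has_vector_derivative B ** transpose B ** R1 A B Q t + A ** R3 A B Q t) (at t)"
    "(R4 A B Q has_vector_derivative B ** transpose B ** R2 A B Q t + A ** R4 A B Q t) (at t)"
proof -
  have f: "(flow A B Q has_vector_derivative - (Omega ** Hmat A B Q) ** flow A B Q t) (at t)"
    using has_vector_derivative_mexp[of "- (Omega ** Hmat A B Q)" t]
    by (simp add: flow_eq[abs_def])
  show "(R1 A B Q has_vector_derivative - (transpose A ** R1 A B Q t) - Q ** R3 A B Q t) (at t)"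
    "(R2 A B Q has_vector_derivative - (transpose A ** R2 A B Q t) - Q ** R4 A B Q t) (at t)"
    "(R3 A B Q has_vector_derivative B ** transpose B ** R1 A B Q t + A ** R3 A B Q t) (at t)"
    "(R4 A B Q has_vector_derivative B ** transpose B ** R2 A B Q t + A ** R4 A B Q t) (at t)"
    using bounded_linear_blk[THEN bounded_linear.has_vector_derivative, OF f,
        unfolded blk_mult, unfolded blk_generator, unfolded matrix_minus_mult]
    by (simp_all add: R1_def[abs_def] R2_def[abs_def] R3_def[abs_def] R4_def[abs_def])
qed

lemma R_0:
  "R1 A B Q 0 = mat 1" "R2 A B Q 0 = 0" "R3 A B Q 0 = 0" "R4 A B Q 0 = mat 1"
  by (simp_all add: R1_def R2_def R3_def R4_def flow_def mexp_0 blk_mat_1)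

section \<open>Solutions of the Hamiltonian system and the conserved symplectic form\<close>

text \<open>\<open>p\<close> is the costate, and \<open>transpose B *v p\<close> is the extremal
  control. Asking for the equations on the whole line admits time shifts and the negative times at
  which the cost formula evaluates the flow.\<close>

definition ham_sol :: "real^'n^'n \<Rightarrow> real^'m^'n \<Rightarrow> real^'n^'n \<Rightarrow>
    (real \<Rightarrow> real^'n) \<Rightarrow> (real \<Rightarrow> real^'n) \<Rightarrow> bool" where
  "ham_sol A B Q p x \<longleftrightarrow> (\<forall>t.
     (p has_vector_derivative - (transpose A *v p t) - Q *v x t) (at t) \<and>
     (x has_vector_derivative B *v (transpose B *v p t) + A *v x t) (at t))"

lemma ham_sol_derivatives:
  assumes "ham_sol A B Q p x"
  shows "(p has_vector_derivative - (transpose A *v p t) - Q *v x t) (at t)"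
    and "(x has_vector_derivative B *v (transpose B *v p t) + A *v x t) (at t)"
  using assms by (auto simp: ham_sol_def)

text \<open>By \<open>R_0\<close> this is the solution with costate \<open>a\<close> and state
  \<open>b\<close> at time 0.\<close>

lemma ham_sol_flow:
  "ham_sol A B Q (\<lambda>t. R1 A B Q t *v a + R2 A B Q t *v b) (\<lambda>t. R3 A B Q t *v a + R4 A B Q t *v b)"
proof -
  note d = R_has_vector_derivative[THEN bounded_linear.has_vector_derivative[
        OF bounded_bilinear.bounded_linear_left[OF bounded_bilinear_matrix_vector_mult]]]
  show ?thesis
    unfolding ham_sol_def
  proof (intro allI conjI)
    fix t
    show "((\<lambda>t. R1 A B Q t *v a + R2 A B Q t *v b) has_vector_derivative
        - (transpose A *v (R1 A B Q t *v a + R2 A B Q t *v b))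
        - Q *v (R3 A B Q t *v a + R4 A B Q t *v b)) (at t)"
      by (rule has_vector_derivative_eq_rhs[OF has_vector_derivative_add[OF d(1) d(2)]])
        (simp add: matrix_vector_mul_assoc algebra_simps matrix_minus_mult_vector)
    show "((\<lambda>t. R3 A B Q t *v a + R4 A B Q t *v b) has_vector_derivative
        B *v (transpose B *v (R1 A B Q t *v a + R2 A B Q t *v b))
        + A *v (R3 A B Q t *v a + R4 A B Q t *v b)) (at t)"
      by (rule has_vector_derivative_eq_rhs[OF has_vector_derivative_add[OF d(3) d(4)]])
        (simp add: matrix_vector_mul_assoc matrix_mul_assoc algebra_simps matrix_minus_mult_vector)
  qed
qed

lemma has_vector_derivative_shift_arg:
  fixes f :: "real \<Rightarrow> 'a::real_normed_vector"
  assumes "(f has_vector_derivative D) (at (t + c))"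
  shows "((\<lambda>t. f (t + c)) has_vector_derivative D) (at t)"
proof -
  have "((\<lambda>t. t + c) has_vector_derivative 1) (at t)"
    by (auto intro!: derivative_eq_intros)
  from vector_diff_chain_at[OF this assms] show ?thesis by (simp add: o_def)
qed

text \<open>The system is autonomous. With \<open>c = - T\<close> a solution given by its data at 0
  becomes one given by its data at \<open>T\<close>.\<close>

lemma ham_sol_shift:
  assumes "ham_sol A B Q p x"
  shows "ham_sol A B Q (\<lambda>t. p (t + c)) (\<lambda>t. x (t + c))"
  unfolding ham_sol_def
  by (intro allI conjI has_vector_derivative_shift_arg ham_sol_derivatives[OF assms])

lemma inner_transpose: "(transpose M *v v) \<bullet> w = v \<bullet> (M *v w)"
  for M :: "real^'n^'m"
  by (simp add: dot_lmul_matrix vector_transpose_matrix flip: dot_lmul_matrix)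

lemma inner_transpose_right: "v \<bullet> (transpose M *v w) = (M *v v) \<bullet> w"
  for M :: "real^'n^'m"
  by (metis inner_transpose inner_commute)

lemma inner_symmetric: "transpose Q = Q \<Longrightarrow> (Q *v v) \<bullet> w = v \<bullet> (Q *v w)"
  for Q :: "real^'n^'n"
  using inner_transpose[of Q v w] by simp

text \<open>In the derivative the terms with \<open>A\<close> cancel by transposition, and those
  with \<open>Q\<close> and \<open>B ** transpose B\<close> by symmetry.\<close>

lemma ham_sol_symplectic:
  fixes A Q :: "real^'n^'n" and B :: "real^'m^'n"
  assumes Q: "transpose Q = Q" and 1: "ham_sol A B Q p x" and 2: "ham_sol A B Q q y"
  shows "p s \<bullet> y s - q s \<bullet> x s = p t \<bullet> y t - q t \<bullet> x t"
proof -
  have B: "p t \<bullet> (B *v (transpose B *v q t)) = q t \<bullet> (B *v (transpose B *v p t))" for t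
    by (metis inner_transpose inner_commute)
  have "((\<lambda>t. p t \<bullet> y t - q t \<bullet> x t) has_vector_derivative 0) (at t)" for t
    by (rule has_vector_derivative_eq_rhs[OF has_vector_derivative_diff[OF
          bounded_bilinear.has_vector_derivative[OF bounded_bilinear_inner
            ham_sol_derivatives(1)[OF 1] ham_sol_derivatives(2)[OF 2]]
          bounded_bilinear.has_vector_derivative[OF bounded_bilinear_inner
            ham_sol_derivatives(1)[OF 2] ham_sol_derivatives(2)[OF 1]]]])
      (simp add: inner_diff_left inner_add_right inner_transpose B
        inner_symmetric[OF Q, of "x t"] inner_commute[of "x t"] del: transpose_matrix_vector)
  then have "((\<lambda>t. p t \<bullet> y t - q t \<bullet> x t) has_real_derivative 0) (at t)" for t
    by (simp add: has_real_derivative_iff_has_vector_derivative)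
  then show ?thesis
    by (metis (no_types, lifting) DERIV_isconst_all)
qed

text \<open>Pairing a solution with those starting at \<^term>\<open>x = 0\<close> through the symplectic form recovers
  its initial point from its endpoint, so the group law of the flow is not needed.\<close>

lemma ham_sol_backward:
  fixes A Q :: "real^'n^'n" and B :: "real^'m^'n"
  assumes Q: "transpose Q = Q" and sol: "ham_sol A B Q p x"
  shows "x 0 = R3 A B Q (- T) *v p T + R4 A B Q (- T) *v x T"
proof -
  let ?w = "R3 A B Q (- T) *v p T + R4 A B Q (- T) *v x T"
  have "a \<bullet> x 0 = a \<bullet> ?w" for a
  proof -
    note a = ham_sol_flow[of A B Q a 0]
    \<comment> \<open>This solution takes the value \<open>(p T, x T)\<close> at time
      \<open>T\<close>, like the given one, and its state at time 0 is \<open>?w\<close>.\<close>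
    note w = ham_sol_shift[OF ham_sol_flow[of A B Q "p T" "x T"], of "- T"]
    show ?thesis
      using ham_sol_symplectic[OF Q a sol, of 0 T] ham_sol_symplectic[OF Q a w, of 0 T]
      by (simp add: R_0)
  qed
  then show ?thesis by (metis vector_eq_ldot)
qed

text \<open>The solution with data \<open>(a, 0)\<close> at time 0 is paired with the one with data
  \<open>(b, 0)\<close> at time \<open>T\<close>; the two sides are the values of the symplectic
  form at 0 and at \<open>T\<close>. In other words \<open>R3\<close> at \<open>- T\<close> is minus
  the transpose of \<open>R3\<close> at \<open>T\<close>.\<close>

lemma R3_uminus_inner:
  fixes A Q :: "real^'n^'n" and B :: "real^'m^'n"
  assumes Q: "transpose Q = Q"
  shows "a \<bullet> (R3 A B Q (- T) *v b) = - ((R3 A B Q T *v a) \<bullet> b)"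
  using ham_sol_symplectic[OF Q ham_sol_flow[of A B Q a 0]
      ham_sol_shift[OF ham_sol_flow[of A B Q b 0], of "- T"], of 0 T]
  by (simp add: R_0 inner_commute)

text \<open>The symplectic form of two solutions with zero initial state vanishes at 0, hence
  always: the flow keeps this subspace Lagrangian. Symmetry of the Riccati matrix comes from
  here.\<close>

lemma R1_R3_inner:
  fixes A Q :: "real^'n^'n" and B :: "real^'m^'n"
  assumes Q: "transpose Q = Q"
  shows "(R1 A B Q t *v a) \<bullet> (R3 A B Q t *v b) = (R1 A B Q t *v b) \<bullet> (R3 A B Q t *v a)"
  using ham_sol_symplectic[OF Q ham_sol_flow[of A B Q a 0] ham_sol_flow[of A B Q b 0], of t 0]
  by (simp add: R_0)

lemma det_nonzero_if_injective:
  fixes M :: "real^'n^'n"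
  assumes "\<And>v. M *v v = 0 \<Longrightarrow> v = 0"
  shows "det M \<noteq> 0"
proof -
  have "\<exists>N. N ** M = mat 1"
    using assms by (simp add: matrix_left_invertible_ker)
  then show ?thesis
    by (simp add: invertible_det_nz[symmetric] invertible_left_inverse)
qed

text \<open>Pairing a kernel vector \<open>v\<close> with the preimage of \<open>v\<close> under
  \<open>R3\<close> at \<open>T\<close> yields \<open>v \<bullet> v = 0\<close>.\<close>

lemma det_R3_uminus:
  fixes A Q :: "real^'n^'n" and B :: "real^'m^'n"
  assumes Q: "transpose Q = Q" and det: "det (R3 A B Q T) \<noteq> 0"
  shows "det (R3 A B Q (- T)) \<noteq> 0"
proof (rule det_nonzero_if_injective)
  fix v assume "R3 A B Q (- T) *v v = 0"
  then have "(R3 A B Q T *v (matrix_inv (R3 A B Q T) *v v)) \<bullet> v = 0"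
    using R3_uminus_inner[OF Q, of "matrix_inv (R3 A B Q T) *v v" A B T v] by simp
  then show "v = 0" by (simp only: matrix_inv_mult_vector[OF det] inner_eq_zero_iff)
qed

section \<open>The Riccati matrix\<close>

text \<open>Where \<open>R3\<close> is invertible, this matrix sends the state to the costate along
  every solution whose state is 0 at time 0.\<close>

definition riccati :: "real^'n^'n \<Rightarrow> real^'m^'n \<Rightarrow> real^'n^'n \<Rightarrow> real \<Rightarrow> real^'n^'n" where
  "riccati A B Q t = R1 A B Q t ** matrix_inv (R3 A B Q t)"

lemma riccati_symmetric:
  fixes A Q :: "real^'n^'n" and B :: "real^'m^'n"
  assumes Q: "transpose Q = Q" and det: "det (R3 A B Q t) \<noteq> 0"
  shows "v \<bullet> (riccati A B Q t *v w) = (riccati A B Q t *v v) \<bullet> w"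
  using R1_R3_inner[OF Q, of A B t "matrix_inv (R3 A B Q t) *v v" "matrix_inv (R3 A B Q t) *v w"]
  by (simp add: riccati_def matrix_inv_mult_vector[OF det] inner_commute
      flip: matrix_vector_mul_assoc)

text \<open>In the product rule the derivative of \<open>R1\<close> contributes
  \<open>- A^* S - Q\<close>, and the derivative of the inverse contributes
  \<open>- S (B B^* S + A)\<close>.\<close>

lemma riccati_has_vector_derivative:
  fixes A Q :: "real^'n^'n" and B :: "real^'m^'n"
  assumes det: "det (R3 A B Q t) \<noteq> 0"
  defines "S \<equiv> riccati A B Q"
  shows "(S has_vector_derivative
      - (transpose A ** S t) - Q - S t ** (B ** transpose B) ** S t - S t ** A) (at t)"
proof -
  have eq: "riccati A B Q = (\<lambda>t. R1 A B Q t ** matrix_inv (R3 A B Q t))"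
    by (simp add: riccati_def fun_eq_iff)
  show ?thesis
    unfolding S_def eq
    by (rule has_vector_derivative_eq_rhs[OF bounded_bilinear.has_vector_derivative[
            OF bounded_bilinear_matrix_matrix_mult R_has_vector_derivative(1)
            has_vector_derivative_matrix_inv[OF R_has_vector_derivative(3) det]]])
      (simp add: matrix_eq algebra_simps matrix_minus_mult_vector matrix_minus_mult
        matrix_inv_mult_vector[OF det] flip: matrix_vector_mul_assoc)
qed

section \<open>Action of extremals and of admissible trajectories\<close>

text \<open>The integral equation is part of admissibility; what remains is integrability of the
  control, which holds because square integrable functions on a bounded interval are
  integrable.\<close>

lemma admissible_ac_on:
  fixes A :: "real^'n^'n" and B :: "real^'m^'n"
  assumes "admissible A B T \<gamma> u"
  shows "ac_on T \<gamma> (\<lambda>s. A *v \<gamma> s + B *v u s)"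
proof -
  let ?u = "\<lambda>s. indicator {0..T} s *\<^sub>R u s"
  have m: "?u \<in> borel_measurable lborel"
    and u2: "set_integrable lborel {0..T} (\<lambda>s. (norm (u s))\<^sup>2)"
    and cont: "continuous_on {0..T} \<gamma>"
    and eq: "\<forall>t\<in>{0..T}. \<gamma> t = \<gamma> 0 + (LINT s:{0..t}|lborel. A *v \<gamma> s + B *v u s)"
    using assms unfolding admissible_def set_borel_measurable_def by blast+
  have "set_integrable lborel {0..T} (\<lambda>s. 1 + (norm (u s))\<^sup>2)"
    by (intro set_integral_add(1) u2 borel_integrable_atLeastAtMost' continuous_intros)
  then have "integrable lborel (\<lambda>s. indicator {0..T} s *\<^sub>R (1 + (norm (u s))\<^sup>2))"
    by (simp add: set_integrable_def)
  moreover have "norm (?u s) \<le> norm (indicator {0..T} s *\<^sub>R (1 + (norm (u s))\<^sup>2))" for s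
  proof -
    have "2 * norm (u s) \<le> 1 + (norm (u s))\<^sup>2"
      using zero_le_power2[of "norm (u s) - 1"] by (simp add: power2_diff)
    then have "norm (u s) \<le> 1 + (norm (u s))\<^sup>2"
      using norm_ge_zero[of "u s"] by linarith
    then show ?thesis by (simp add: indicator_def)
  qed
  ultimately have "integrable lborel ?u"
    by (rule Bochner_Integration.integrable_bound[OF _ m AE_I2])
  then have "integrable lborel (\<lambda>s. B *v ?u s)"
    by (rule integrable_bounded_linear[OF matrix_vector_mul_bounded_linear])
  then have "set_integrable lborel {0..T} (\<lambda>s. B *v u s)"
    by (simp add: set_integrable_def matrix_vector_mult_scaleR)
  moreover have "set_integrable lborel {0..T} (\<lambda>s. A *v \<gamma> s)"
    by (intro borel_integrable_atLeastAtMost' cont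
        bounded_linear.continuous_on[OF matrix_vector_mul_bounded_linear])
  ultimately show ?thesis
    unfolding ac_on_def using eq by (intro conjI set_integral_add(1))
qed

text \<open>Comparing integrals by monotonicity is legitimate only for integrable functions, as the
  integral of any other function is 0 by convention.\<close>

lemma set_integrable_lagrangian:
  fixes A Q :: "real^'n^'n" and B :: "real^'m^'n"
  assumes "admissible A B T \<gamma> u"
  shows "set_integrable lborel {0..T} (\<lambda>s. (norm (u s))\<^sup>2 - \<gamma> s \<bullet> (Q *v \<gamma> s))"
proof -
  have "continuous_on {0..T} \<gamma>" and u: "set_integrable lborel {0..T} (\<lambda>s. (norm (u s))\<^sup>2)"
    using assms unfolding admissible_def by blast+
  then have "set_integrable lborel {0..T} (\<lambda>s. \<gamma> s \<bullet> (Q *v \<gamma> s))"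
    by (intro borel_integrable_atLeastAtMost' continuous_intros
        bounded_linear.continuous_on[OF matrix_vector_mul_bounded_linear])
  with u show ?thesis by (rule set_integral_diff(1))
qed

lemma ham_sol_continuous:
  assumes "ham_sol A B Q p x"
  shows "continuous_on I p" "continuous_on I x"
  using ham_sol_derivatives[OF assms, THEN has_vector_derivative_continuous]
  by (auto intro: continuous_at_imp_continuous_on)

lemma ham_sol_ac_on:
  fixes A Q :: "real^'n^'n" and B :: "real^'m^'n"
  assumes "ham_sol A B Q p x"
  shows "ac_on T p (\<lambda>t. - (transpose A *v p t) - Q *v x t)"
    and "ac_on T x (\<lambda>t. B *v (transpose B *v p t) + A *v x t)"
proof -
  note cont = ham_sol_continuous[OF assms, of "{0..T}"]
  note bl = bounded_linear.continuous_on[OF matrix_vector_mul_bounded_linear]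
  show "ac_on T p (\<lambda>t. - (transpose A *v p t) - Q *v x t)"
    by (rule ac_on_C1[OF ham_sol_derivatives(1)[OF assms]]) (intro continuous_intros bl cont)
  show "ac_on T x (\<lambda>t. B *v (transpose B *v p t) + A *v x t)"
    by (rule ac_on_C1[OF ham_sol_derivatives(2)[OF assms]]) (intro continuous_intros bl cont)
qed

lemma ham_sol_admissible:
  fixes A Q :: "real^'n^'n" and B :: "real^'m^'n"
  assumes sol: "ham_sol A B Q p x"
  shows "admissible A B T x (\<lambda>t. transpose B *v p t)"
proof -
  have u: "continuous_on {0..T} (\<lambda>t. transpose B *v p t)"
    by (intro ham_sol_continuous(1)[OF sol]
        bounded_linear.continuous_on[OF matrix_vector_mul_bounded_linear])
  show ?thesis
    unfolding admissible_def
  proof (intro conjI ballI)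
    show "set_borel_measurable lborel {0..T} (\<lambda>t. transpose B *v p t)"
      using borel_measurable_continuous_on_indicator[OF _ u]
      by (simp add: set_borel_measurable_def)
    show "set_integrable lborel {0..T} (\<lambda>t. (norm (transpose B *v p t))\<^sup>2)"
      by (intro borel_integrable_atLeastAtMost' continuous_intros u)
    show "continuous_on {0..T} x" by (rule ham_sol_continuous(2)[OF sol])
    show "x t = x 0 + (LINT s:{0..t}|lborel. A *v x s + B *v (transpose B *v p s))"
      if "t \<in> {0..T}" for t
      using ac_on_eq[OF ham_sol_ac_on(2)[OF sol] that] by (simp only: add.commute)
  qed
qed

text \<open>The left side is the derivative of \<open>p \<bullet> x\<close> along a solution, and
  the right side is twice the Lagrangian with the extremal control. The terms with \<open>A\<close>
  cancel.\<close>

lemma ham_sol_inner_derivative: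
  fixes A Q :: "real^'n^'n" and B :: "real^'m^'n"
  shows "(- (transpose A *v p) - Q *v x) \<bullet> x + p \<bullet> (B *v (transpose B *v p) + A *v x)
    = (norm (transpose B *v p))\<^sup>2 - x \<bullet> (Q *v x)"
  by (simp add: inner_diff_left inner_add_right inner_transpose inner_commute[of "Q *v x"]
      power2_norm_eq_inner del: transpose_matrix_vector)

lemma action_ham_sol:
  fixes A Q :: "real^'n^'n" and B :: "real^'m^'n"
  assumes sol: "ham_sol A B Q p x" and "0 \<le> T"
  shows "action Q T x (\<lambda>t. transpose B *v p t) = (p T \<bullet> x T - p 0 \<bullet> x 0) / 2"
proof -
  have "p T \<bullet> x T = p 0 \<bullet> x 0 + (LINT s:{0..T}|lborel. (norm (transpose B *v p s))\<^sup>2 - x s \<bullet> (Q *v x s))"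
    using ac_on_eq[OF ac_on_bilinear[OF bounded_bilinear_inner
          ham_sol_ac_on(1)[OF sol] ham_sol_ac_on(2)[OF sol]], of T T] \<open>0 \<le> T\<close>
    unfolding ham_sol_inner_derivative by simp
  then show ?thesis by (simp add: action_def)
qed

text \<open>Completing the square: along \<^term>\<open>\<gamma> = x + e\<close> the excess of the Lagrangian over the
  derivative of \<^term>\<open>e \<bullet> (S *v e) + 2 * (p \<bullet> e) + p \<bullet> x\<close> is a square as soon as
  \<^term>\<open>S\<close> solves the Riccati equation.\<close>

lemma riccati_square:
  fixes A Q S S' :: "real^'n^'n" and B :: "real^'m^'n"
  assumes Q: "transpose Q = Q" and S: "\<And>v w. v \<bullet> (S *v w) = (S *v v) \<bullet> w"
    and S': "S' = - (transpose A ** S) - Q - S ** (B ** transpose B) ** S - S ** A"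
    and p': "p' = - (transpose A *v p) - Q *v x"
    and x': "x' = B *v (transpose B *v p) + A *v x"
    and e: "e = g - x" and e': "e' = A *v g + B *v u - x'"
  shows "e' \<bullet> (S *v e) + e \<bullet> (S' *v e + S *v e') + (2 * (p' \<bullet> e + p \<bullet> e') + (p' \<bullet> x + p \<bullet> x'))
    = (norm u)\<^sup>2 - g \<bullet> (Q *v g) - (norm (u - transpose B *v p - transpose B *v (S *v e)))\<^sup>2"
proof -
  \<comment> \<open>\<open>w\<close> is the extremal control, \<open>v\<close> the deviation from
    it, which drives the difference \<open>e\<close>, and \<open>b\<close> the feedback that the
    Riccati matrix prescribes for \<open>v\<close>. The square to be found is that of
    \<open>v - b\<close>.\<close>
  define s where "s = S *v e"
  define b where "b = transpose B *v s"
  define w where "w = transpose B *v p"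
  define v where "v = u - w"
  have g: "g = x + e" using e by simp
  have e': "e' = A *v e + B *v v"
    by (simp add: e' x' e v_def w_def algebra_simps del: transpose_matrix_vector)
  have B1: "s \<bullet> (B *v z) = b \<bullet> z" and B2: "p \<bullet> (B *v z) = w \<bullet> z" for z
    by (simp_all add: b_def w_def inner_transpose del: transpose_matrix_vector)
  have "S' *v e = - (transpose A *v s) - Q *v e - S *v (B *v b) - S *v (A *v e)"
    by (simp add: S' s_def b_def matrix_vector_mult_diff_rdistrib matrix_minus_mult_vector
        del: transpose_matrix_vector flip: matrix_vector_mul_assoc)
  then have "e \<bullet> (S' *v e) = - (s \<bullet> (A *v e)) - e \<bullet> (Q *v e) - b \<bullet> b - s \<bullet> (A *v e)"
    by (simp add: inner_diff_right S B1 inner_transpose_right inner_commute[of "A *v e"]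
        del: transpose_matrix_vector flip: s_def)
  moreover have "e \<bullet> (S *v e') = s \<bullet> (A *v e) + b \<bullet> v"
    by (simp add: S e' inner_add_right B1 flip: s_def)
  moreover have "e' \<bullet> (S *v e) = s \<bullet> (A *v e) + b \<bullet> v"
    by (simp only: e' inner_commute[of "A *v e + B *v v"] inner_add_right B1 s_def[symmetric])
  moreover have "p' \<bullet> e + p \<bullet> e' = - (x \<bullet> (Q *v e)) + w \<bullet> v"
    by (simp add: p' e' inner_diff_left inner_add_right inner_transpose inner_symmetric[OF Q] B2
        del: transpose_matrix_vector)
  moreover have "p' \<bullet> x + p \<bullet> x' = w \<bullet> w - x \<bullet> (Q *v x)"
    unfolding p' x' ham_sol_inner_derivative by (simp add: w_def power2_norm_eq_inner)
  moreover have "e \<bullet> (Q *v x) = x \<bullet> (Q *v e)"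
    by (metis inner_symmetric[OF Q] inner_commute)
  then have "g \<bullet> (Q *v g) = x \<bullet> (Q *v x) + 2 * (x \<bullet> (Q *v e)) + e \<bullet> (Q *v e)"
    by (simp add: g matrix_vector_right_distrib inner_add_left inner_add_right)
  moreover have "(norm u)\<^sup>2 - (norm (u - w - b))\<^sup>2
      = 2 * (b \<bullet> v) - b \<bullet> b + 2 * (w \<bullet> v) + w \<bullet> w"
    by (simp add: v_def power2_norm_eq_inner inner_diff_left inner_diff_right inner_commute
        algebra_simps)
  ultimately show ?thesis
    by (simp only: inner_add_right s_def[symmetric] b_def[symmetric] w_def[symmetric]) argo
qed

text \<open>By \<open>riccati_square\<close> the density of \<open>F\<close> is at most twice the
  Lagrangian. As \<open>e\<close> vanishes at both endpoints, the increment of \<open>F\<close> is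
  that of \<open>p \<bullet> x\<close>. \<open>S\<close> is kept general so that a time shift of the
  Riccati matrix can be inserted.\<close>

lemma action_ge_ham_sol:
  fixes A Q :: "real^'n^'n" and B :: "real^'m^'n" and S S' :: "real \<Rightarrow> real^'n^'n"
  assumes Q: "transpose Q = Q" and "0 \<le> T"
    and Sd: "\<And>t. t \<in> {0..T} \<Longrightarrow> (S has_vector_derivative S' t) (at t)"
    and S': "\<And>t. S' t = - (transpose A ** S t) - Q - S t ** (B ** transpose B) ** S t - S t ** A"
    and S: "\<And>t v w. t \<in> {0..T} \<Longrightarrow> v \<bullet> (S t *v w) = (S t *v v) \<bullet> w"
    and sol: "ham_sol A B Q p x" and adm: "admissible A B T \<gamma> u"
    and ends: "\<gamma> 0 = x 0" "\<gamma> T = x T"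
  shows "(p T \<bullet> x T - p 0 \<bullet> x 0) / 2 \<le> action Q T \<gamma> u"
proof -
  note mm = bounded_bilinear.continuous_on[OF bounded_bilinear_matrix_matrix_mult]
  let ?x' = "\<lambda>t. B *v (transpose B *v p t) + A *v x t"
  let ?p' = "\<lambda>t. - (transpose A *v p t) - Q *v x t"
  let ?L = "\<lambda>t. (norm (u t))\<^sup>2 - \<gamma> t \<bullet> (Q *v \<gamma> t)"
  define e where "e t = \<gamma> t - x t" for t
  define e' where "e' t = A *v \<gamma> t + B *v u t - ?x' t" for t
  have "continuous_on {0..T} S"
    using Sd[THEN has_vector_derivative_continuous] by (auto intro: continuous_at_imp_continuous_on)
  \<comment> \<open>The Riccati equation makes \<open>S'\<close> a polynomial in
    \<open>S\<close>.\<close>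
  then have "continuous_on {0..T} S'"
    unfolding S' by (intro continuous_intros mm)
  with Sd have acS: "ac_on T S S'"
    by (rule ac_on_C1)
  have acp: "ac_on T p ?p'" and acx: "ac_on T x ?x'"
    by (rule ham_sol_ac_on[OF sol])+
  have ace: "ac_on T e e'"
    unfolding e_def[abs_def] e'_def[abs_def] by (rule ac_on_diff[OF admissible_ac_on[OF adm] acx])
  define F where "F t = e t \<bullet> (S t *v e t) + (2 * (p t \<bullet> e t) + p t \<bullet> x t)" for t
  define F' where "F' t = e' t \<bullet> (S t *v e t) + e t \<bullet> (S' t *v e t + S t *v e' t)
      + (2 * (?p' t \<bullet> e t + p t \<bullet> e' t) + (?p' t \<bullet> x t + p t \<bullet> ?x' t))" for t
  have acF: "ac_on T F F'"
    unfolding F_def[abs_def] F'_def[abs_def]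
    by (intro ac_on_add ac_on_cmult ac_on_bilinear[OF bounded_bilinear_inner] ace acp acx
        ac_on_bilinear[OF bounded_bilinear_matrix_vector_mult] acS)
  have "F' t \<le> ?L t" if "t \<in> {0..T}" for t
    using riccati_square[OF Q S[OF that] S'[of t] refl refl e_def e'_def]
    by (simp add: F'_def)
  then have "(LINT s:{0..T}|lborel. F' s) \<le> (LINT s:{0..T}|lborel. ?L s)"
    by (intro set_integral_mono ac_on_integrable[OF acF] set_integrable_lagrangian[OF adm])
  moreover have "F T = F 0 + (LINT s:{0..T}|lborel. F' s)"
    using ac_on_eq[OF acF, of T] \<open>0 \<le> T\<close> by simp
  ultimately show ?thesis
    using ends by (simp add: F_def e_def action_def)
qed

section \<open>Conjugate times and the value of the cost\<close>

lemma xpart_flow: "xpart (flow A B Q t *v pairvec p 0) = R3 A B Q t *v p"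
  by (simp add: xpart_def pairvec_def R3_def blk3_def vec_eq_iff matrix_vector_mult_def sum_UNIV_Plus)

text \<open>A nonzero kernel vector of \<open>R3\<close> at \<open>t\<close> is an initial costate
  that makes \<open>t\<close> a conjugate time, which contradicts \<open>t\<close> lying below the
  infimum.\<close>

lemma det_R3_nonzero:
  fixes A Q :: "real^'n^'n" and B :: "real^'m^'n"
  assumes "ereal T < first_conj_time A B Q" and "0 < t" "t \<le> T"
  shows "det (R3 A B Q t) \<noteq> 0"
proof (rule det_nonzero_if_injective)
  have "\<not> conjugate_time A B Q t"
  proof
    assume "conjugate_time A B Q t"
    then have "first_conj_time A B Q \<le> ereal t"
      unfolding first_conj_time_def by (intro Inf_lower) blast
    also have "\<dots> \<le> ereal T" using \<open>t \<le> T\<close> by simp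
    finally show False using assms(1) by simp
  qed
  then show "v = 0" if "R3 A B Q t *v v = 0" for v
    using that \<open>0 < t\<close> by (auto simp: conjugate_time_def xpart_flow)
qed

text \<open>Continuity of the determinant at \<open>T\<close> pushes invertibility up to
  \<open>T + c\<close>. Half of \<open>c\<close> keeps the shifted times below that bound, while
  positivity keeps them away from 0, where \<open>R3\<close> is singular.\<close>

lemma det_R3_nonzero_beyond:
  fixes A Q :: "real^'n^'n" and B :: "real^'m^'n"
  assumes T: "ereal T < first_conj_time A B Q" "0 < T"
  obtains d where "d > 0" "\<And>t. t \<in> {0..T} \<Longrightarrow> det (R3 A B Q (t + d)) \<noteq> 0"
proof -
  have det: "det (R3 A B Q T) \<noteq> 0" using det_R3_nonzero[OF T(1)] T(2) by simp
  have "(R3 A B Q \<longlongrightarrow> R3 A B Q T) (at T)"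
    using has_vector_derivative_continuous[OF R_has_vector_derivative(3)]
    by (simp add: continuous_at)
  from tendsto_imp_eventually_ne[OF tendsto_det[OF this] det]
  obtain c where c: "c > 0" "\<And>t. t \<noteq> T \<Longrightarrow> dist t T < c \<Longrightarrow> det (R3 A B Q t) \<noteq> 0"
    by (auto simp: eventually_at)
  have "det (R3 A B Q (t + c / 2)) \<noteq> 0" if "t \<in> {0..T}" for t
  proof (cases "t + c / 2 \<le> T")
    case True
    then show ?thesis using det_R3_nonzero[OF T(1)] that c(1) by simp
  next
    case False
    then show ?thesis using c(2)[of "t + c / 2"] that c(1) by (simp add: dist_real_def)
  qed
  with c(1) that[of "c / 2"] show thesis by simp
qed

theorem theorem2p16:
  fixes A :: "real^'n^'n" and B :: "real^'m^'n" and Q :: "real^'n^'n" and T :: real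
  assumes "CARD('m) \<le> CARD('n)"
    and "rank B = CARD('m)"
    and "transpose Q = Q"
    and "kalman A B"
    and "0 < T"
    and "ereal T < first_conj_time A B Q"
  shows "\<forall>x y. lq_cost A B Q T x y =
     ereal (x \<bullet> ((matrix_inv (R3 A B Q T) ** R4 A B Q T) *v x) / 2
            - x \<bullet> (matrix_inv (R3 A B Q T) *v y)
            - y \<bullet> ((matrix_inv (R3 A B Q (-T)) ** R4 A B Q (-T)) *v y) / 2)"
proof (intro allI)
  fix x y :: "real^'n"
  note Q = \<open>transpose Q = Q\<close>
  let ?R3 = "R3 A B Q T" and ?R4 = "R4 A B Q T"
  let ?N3 = "R3 A B Q (- T)" and ?N4 = "R4 A B Q (- T)"
  have det: "det ?R3 \<noteq> 0" using det_R3_nonzero assms(5,6) by blast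
  note det' = det_R3_uminus[OF Q det]
  \<comment> \<open>The initial costate of the extremal from \<open>x\<close> to \<open>y\<close>:
    it solves \<open>R3 p0 + R4 x = y\<close> at time \<open>T\<close>.\<close>
  define p0 where "p0 = matrix_inv ?R3 *v (y - ?R4 *v x)"
  define p where "p t = R1 A B Q t *v p0 + R2 A B Q t *v x" for t
  define \<xi> where "\<xi> t = R3 A B Q t *v p0 + R4 A B Q t *v x" for t
  have sol: "ham_sol A B Q p \<xi>"
    unfolding p_def[abs_def] \<xi>_def[abs_def] by (rule ham_sol_flow)
  have p_0: "p 0 = p0" and \<xi>_0: "\<xi> 0 = x" by (simp_all add: p_def \<xi>_def R_0)
  have \<xi>_T: "\<xi> T = y"
    by (simp add: \<xi>_def p0_def matrix_inv_mult_vector[OF det])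
  \<comment> \<open>Writing \<open>y\<close> as \<open>R3 q\<close> brings products with
    \<open>y\<close> into the form that \<open>R3_uminus_inner\<close> handles.\<close>
  define q where "q = matrix_inv ?R3 *v y"
  have q: "?R3 *v q = y" by (simp add: q_def matrix_inv_mult_vector[OF det])
  \<comment> \<open>Running the extremal backward from \<open>y\<close> determines \<open>R3\<close>
    at \<open>- T\<close> applied to the final costate; paired with \<open>q\<close>, this is all
    that is needed of \<open>p T\<close>.\<close>
  have "x = ?N3 *v p T + ?N4 *v y"
    using ham_sol_backward[OF Q sol, of T] by (simp add: \<xi>_0 \<xi>_T)
  then have "?N3 *v p T = x - ?N4 *v y" by simp
  then have pT: "p T \<bullet> y = - (q \<bullet> x) + q \<bullet> (?N4 *v y)"
    using R3_uminus_inner[OF Q, of q A B T "p T"]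
    by (simp add: q inner_diff_right inner_commute)
  have r: "y \<bullet> (matrix_inv ?N3 *v (?N4 *v y)) = - (q \<bullet> (?N4 *v y))"
    using R3_uminus_inner[OF Q, of q A B T "matrix_inv ?N3 *v (?N4 *v y)"]
    by (simp add: q matrix_inv_mult_vector[OF det'])
  \<comment> \<open>The product \<open>q \<bullet> x\<close> arises at both ends, from
    \<open>pT\<close> and from \<open>p0\<close>, so the mixed term carries no factor one
    half.\<close>
  have val: "(p T \<bullet> \<xi> T - p 0 \<bullet> \<xi> 0) / 2
      = x \<bullet> ((matrix_inv ?R3 ** ?R4) *v x) / 2 - x \<bullet> (matrix_inv ?R3 *v y)
        - y \<bullet> ((matrix_inv ?N3 ** ?N4) *v y) / 2" (is "_ = ?c")
    by (simp add: \<xi>_0 \<xi>_T p_0 pT p0_def r inner_diff_left inner_commute[of _ x]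
        matrix_vector_mult_diff_distrib inner_diff_right field_simps
        flip: matrix_vector_mul_assoc q_def)
  obtain d where d: "\<And>t. t \<in> {0..T} \<Longrightarrow> det (R3 A B Q (t + d)) \<noteq> 0"
    using det_R3_nonzero_beyond[OF assms(6,5)] by blast
  define S where "S t = riccati A B Q (t + d)" for t
  define S' where "S' t = - (transpose A ** S t) - Q - S t ** (B ** transpose B) ** S t - S t ** A" for t
  have Sd: "(S has_vector_derivative S' t) (at t)" if "t \<in> {0..T}" for t
    unfolding S_def[abs_def] S'_def
    by (rule has_vector_derivative_shift_arg riccati_has_vector_derivative d that)+
  have low: "?c \<le> action Q T \<gamma> u" if "admissible A B T \<gamma> u" "\<gamma> 0 = x" "\<gamma> T = y" for \<gamma> u
    unfolding val[symmetric]
    by (rule action_ge_ham_sol[OF Q _ Sd S'_def _ sol that(1)])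
      (use assms(5) that d in \<open>auto simp: S_def \<xi>_0 \<xi>_T intro: riccati_symmetric[OF Q]\<close>)
  have att: "action Q T \<xi> (\<lambda>t. transpose B *v p t) = ?c"
    using action_ham_sol[OF sol, of T] assms(5) val by simp
  show "lq_cost A B Q T x y = ereal ?c"
    unfolding lq_cost_def
  proof (rule antisym)
    show "Inf {ereal (action Q T \<gamma> u) |\<gamma> u. admissible A B T \<gamma> u \<and> \<gamma> 0 = x \<and> \<gamma> T = y} \<le> ereal ?c"
    proof (rule Inf_lower, rule CollectI, intro exI conjI)
      show "ereal ?c = ereal (action Q T \<xi> (\<lambda>t. transpose B *v p t))"
        by (simp only: att)
    qed (rule ham_sol_admissible[OF sol] \<xi>_0 \<xi>_T)+
    show "ereal ?c \<le> Inf {ereal (action Q T \<gamma> u) |\<gamma> u. admissible A B T \<gamma> u \<and> \<gamma> 0 = x \<and> \<gamma> T = y}"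
      by (rule Inf_greatest) (use low in auto)
  qed
qed

end
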